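(* Let $p$ be a prime, let $R$ be an integral domain of characteristic $p$, and let $D=x_1^r f_1(x_1^p)\partial_1$ be a nonzero derivation of $R[x_1]$, where $r\in\mathbb{N}$ and $f_1(x_1^p)\in R[x_1^p]$ is a polynomial in $x_1^p$. Then $D$ is locally nilpotent if and only if $r\neq lp+1$ for every $l\in\mathbb{N}$.
   Context: $\partial_1=\frac{\partial}{\partial x_1}$; $\mathbb{N}$ includes $0$. An $R$-linear endomorphism $\eta$ of $R[x_1]$ is locally nilpotent if for each $a\in R[x_1]$ there exists $m\geq1$ with $\eta^m(a)=0$. *)

theory Defs
  imports "HOL-Computational_Algebra.Computational_Algebra"
begin

text \<open>The polynomial ring \<open>R[x\<^sub>1]\<close> is \<open>'a poly\<close>, an \<open>R\<close>-module via \<^const>\<open>smult\<close>, and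
  \<open>\<partial>\<^sub>1\<close> is \<^const>\<open>pderiv\<close>.\<close>

definition poly_derivation :: "('a::comm_ring_1 poly \<Rightarrow> 'a poly) \<Rightarrow> bool" where
  "poly_derivation D \<longleftrightarrow>
     module_hom smult smult D \<and> (\<forall>g h. D (g * h) = g * D h + h * D g)"

text \<open>Only meant for \<open>R\<close>-linear \<open>\<eta>\<close>; linearity is not part of the predicate.\<close>

definition locally_nilpotent :: "('a::comm_ring_1 poly \<Rightarrow> 'a poly) \<Rightarrow> bool" where
  "locally_nilpotent \<eta> \<longleftrightarrow> (\<forall>a. \<exists>m\<ge>1. (\<eta> ^^ m) a = 0)"

text \<open>The operator \<open>x\<^sub>1\<^sup>r f(x\<^sub>1\<^sup>p) \<partial>\<^sub>1\<close>.\<close>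

definition xrf_deriv :: "nat \<Rightarrow> nat \<Rightarrow> 'a::idom poly \<Rightarrow> 'a poly \<Rightarrow> 'a poly" where
  "xrf_deriv p r f g = monom 1 r * pcompose f (monom 1 p) * pderiv g"

lemma poly_derivation_xrf_deriv:
  fixes f :: "'a::idom poly"
  shows "poly_derivation (xrf_deriv p r f)"
proof -
  have "module_hom smult smult (xrf_deriv p r f)"
    by unfold_locales
      (simp_all add: xrf_deriv_def pderiv_add pderiv_smult smult_add_left smult_add_right
        distrib_left)
  moreover have "xrf_deriv p r f (g * h) = g * xrf_deriv p r f h + h * xrf_deriv p r f g" for g h
    by (simp add: xrf_deriv_def pderiv_mult algebra_simps)
  ultimately show ?thesis
    by (simp add: poly_derivation_def)
qed

end

theory Submission
  imports Defs
begin

text \<open>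
  Write \<open>x\<close> for the variable and \<open>F = f(x\<^sup>p)\<close>.  In characteristic \<open>p\<close> the derivative of \<open>F\<close> is
  zero, so \<open>D\<close> treats \<open>F\<close> like a scalar and, up to such scalars, maps powers of \<open>x\<close> to
  powers of \<open>x\<close>.  The \<open>i\<close>-th application (counting from \<open>0\<close>) meets the exponent
  \<open>n + i(r - 1)\<close>, whence
  \<open>x\<^sup>m D\<^sup>m(x\<^sup>n) = F\<^sup>m (\<Prod>i<m. n + i(r - 1)) x\<^bsup>n + mr\<^esup>\<close>,
  which is \<open>power_mult_xrf_deriv_funpow_power\<close>.  Everything is decided by whether
  the coefficient product vanishes in \<open>R\<close>.

  If \<open>r \<equiv> 1\<close> modulo \<open>p\<close>, all factors equal \<open>n\<close>; for \<open>n = 1\<close> the product is \<open>1\<close>, and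
  \<open>F \<noteq> 0\<close> because \<open>D \<noteq> 0\<close>, so no iterate of \<open>D\<close> kills \<open>x\<close>.  Otherwise \<open>r - 1\<close> is a unit
  modulo \<open>p\<close>, the numbers \<open>n + i(r - 1)\<close> with \<open>i < p\<close> run through all residues, and one of them
  is zero (\<open>arith_progression_hits_0_CHAR\<close>); so \<open>D\<^sup>p\<close> kills every power of \<open>x\<close> and hence, by
  linearity, everything.  Since \<open>r\<close> is a natural number, \<open>r \<equiv> 1\<close> means exactly that
  \<open>r = lp + 1\<close> with \<open>l \<ge> 0\<close>: the only other candidate, \<open>r = 0\<close>, would need \<open>p\<close> to divide \<open>1\<close>.
\<close>

lemma pderiv_pcompose_monom_CHAR:
  fixes f :: "'a::idom poly"
  shows "pderiv (pcompose f (monom 1 CHAR('a))) = 0"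
  by (simp add: pderiv_pcompose pderiv_monom)

lemma xrf_deriv_funpow_add:
  "(xrf_deriv p r f ^^ m) (g + h) = (xrf_deriv p r f ^^ m) g + (xrf_deriv p r f ^^ m) h"
  by (induction m) (simp_all add: xrf_deriv_def pderiv_add algebra_simps)

lemma xrf_deriv_funpow_0: "(xrf_deriv p r f ^^ m) 0 = 0"
  by (induction m) (simp_all add: xrf_deriv_def)

lemma xrf_deriv_funpow_smult:
  "(xrf_deriv p r f ^^ m) (smult c g) = smult c ((xrf_deriv p r f ^^ m) g)"
  by (induction m) (simp_all add: xrf_deriv_def pderiv_smult)

lemma xrf_deriv_funpow_sum:
  "(xrf_deriv p r f ^^ m) (sum g A) = (\<Sum>i\<in>A. (xrf_deriv p r f ^^ m) (g i))"
  by (induction A rule: infinite_finite_induct)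
    (simp_all add: xrf_deriv_funpow_0 xrf_deriv_funpow_add)

lemma xrf_deriv_funpow_eq_0I:
  assumes "\<And>n. (xrf_deriv p r f ^^ m) (monom 1 n) = 0"
  shows "(xrf_deriv p r f ^^ m) g = 0"
proof -
  have "(xrf_deriv p r f ^^ m) (monom c n) = 0" for c n
    using xrf_deriv_funpow_smult[of m p r f c "monom 1 n"] assms by (simp add: smult_monom)
  hence "(xrf_deriv p r f ^^ m) (\<Sum>i\<le>degree g. monom (coeff g i) i) = 0"
    by (simp add: xrf_deriv_funpow_sum)
  thus ?thesis by (simp add: poly_as_sum_of_monoms)
qed

text \<open>The factor \<open>x\<^sup>m\<close> on the left keeps all exponents natural: without it the right-hand side would
  carry \<open>x\<^bsup>n + m(r - 1)\<^esup>\<close>, which for \<open>r = 0\<close> makes sense only as long as \<open>m \<le> n\<close>.\<close>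

lemma power_mult_xrf_deriv_funpow_power:
  fixes f :: "'a::idom poly"
  assumes p: "CHAR('a) = p"
  shows "monom 1 m * (xrf_deriv p r f ^^ m) (monom 1 n) =
    pcompose f (monom 1 p) ^ m *
    monom (\<Prod>i<m. of_nat n + of_nat i * (of_nat r - 1)) (n + m * r)"
proof (induction m)
  case 0
  show ?case by simp
next
  case (Suc m)
  define F where "F = pcompose f (monom 1 p)"
  define c :: 'a where "c = (\<Prod>i<m. of_nat n + of_nat i * (of_nat r - 1))"
  define G where "G = (xrf_deriv p r f ^^ m) (monom 1 n)"
  have x_pderiv: "monom 1 1 * pderiv (monom b k) = smult (of_nat k) (monom b k)" for b :: 'a and k
    by (cases k) (simp_all add: pderiv_monom mult_monom smult_monom)
  have F': "pderiv (F ^ m) = 0"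
    using pderiv_pcompose_monom_CHAR[of f] p by (cases m) (simp_all add: F_def pderiv_power_Suc del: power_Suc)
  have IH: "monom 1 m * G = F ^ m * monom c (n + m * r)"
    using Suc.IH by (simp add: F_def c_def G_def)
  \<comment> \<open>Apply the Euler operator \<open>x\<partial>\<close> to both sides of the induction hypothesis: it acts on a power
    of \<open>x\<close> as multiplication by the exponent.\<close>
  have "monom 1 1 * pderiv (monom 1 m * G) =
      (monom 1 1 * pderiv (monom 1 m)) * G + (monom 1 1 * monom 1 m) * pderiv G"
    by (simp only: pderiv_mult distrib_left mult_ac add_ac)
  also have "\<dots> = smult (of_nat m) (monom 1 m * G) + monom 1 (Suc m) * pderiv G"
    by (simp only: x_pderiv mult_monom mult_smult_left) simp
  finally have "monom 1 1 * pderiv (monom 1 m * G) =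
      smult (of_nat m) (monom 1 m * G) + monom 1 (Suc m) * pderiv G" .
  moreover have "monom 1 1 * pderiv (F ^ m * monom c (n + m * r)) =
      smult (of_nat (n + m * r)) (F ^ m * monom c (n + m * r))"
    using x_pderiv[of c "n + m * r"]
    by (simp only: pderiv_mult F' mult_zero_right add_0_right mult.left_commute[of _ "F ^ m"]
        mult_smult_right)
  ultimately have "monom 1 (Suc m) * pderiv G =
      smult (of_nat (n + m * r) - of_nat m) (F ^ m * monom c (n + m * r))"
    unfolding IH by (metis add_diff_cancel_left' smult_diff_left)
  hence "F * monom 1 r * (monom 1 (Suc m) * pderiv G) =
      F * monom 1 r * smult (of_nat (n + m * r) - of_nat m) (F ^ m * monom c (n + m * r))"
    by simp
  also have "\<dots> = F ^ Suc m *
      monom (c * (of_nat n + of_nat m * (of_nat r - 1))) (n + Suc m * r)"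
  proof -
    have "monom 1 r * smult (of_nat (n + m * r) - of_nat m) (monom c (n + m * r)) =
      monom (c * (of_nat n + of_nat m * (of_nat r - 1))) (n + Suc m * r)"
      by (simp add: smult_monom mult_monom algebra_simps)
    from arg_cong[OF this, of "\<lambda>t. F ^ Suc m * t"] show ?thesis
      by (simp only: mult_smult_right mult_smult_left power_Suc mult_ac)
  qed
  finally have "F * monom 1 r * (monom 1 (Suc m) * pderiv G) = F ^ Suc m *
      monom (c * (of_nat n + of_nat m * (of_nat r - 1))) (n + Suc m * r)" .
  moreover have "(xrf_deriv p r f ^^ Suc m) (monom 1 n) = monom 1 r * F * pderiv G"
    by (simp add: xrf_deriv_def[of p r f G] F_def flip: G_def)
  ultimately show ?case
    by (simp only: prod.lessThan_Suc F_def c_def mult_ac)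
qed

text \<open>If the prime characteristic does not divide \<open>d\<close>, then \<open>d\<close> is a unit modulo it, so the
  progression \<open>n, n + d, n + 2d, \<dots>\<close> passes through zero within one period.\<close>

lemma arith_progression_hits_0_CHAR:
  fixes n d :: int
  assumes "prime CHAR('a::comm_ring_1)" and "\<not> int CHAR('a) dvd d"
  shows "\<exists>i<CHAR('a). of_int n + of_nat i * of_int d = (0::'a)"
proof -
  let ?p = "int CHAR('a)"
  have pos: "?p > 0" using assms(1) by (simp add: prime_gt_0_nat)
  have "coprime ?p d" using assms by (intro prime_imp_coprime) auto
  then obtain u v where uv: "u * d + v * ?p = 1"
    using bezout_int[of d ?p] by (auto simp: coprime_iff_gcd_eq_1 gcd.commute)
  \<comment> \<open>Since \<open>u\<close> inverts \<open>d\<close> modulo the characteristic, \<open>n + i d \<equiv> 0\<close> is solved by \<open>- n u\<close>.\<close>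
  define i where "i = nat ((- n * u) mod ?p)"
  have i: "int i = (- n * u) mod ?p" using pos by (simp add: i_def)
  have "int i < ?p" unfolding i using pos by simp
  moreover have "?p dvd n + int i * d"
  proof -
    obtain q where "int i = - n * u - ?p * q"
      unfolding i by (metis minus_mult_div_eq_mod)
    hence "n + int i * d = n * (1 - u * d) - ?p * q * d"
      by (simp only:) (simp add: algebra_simps)
    also have "1 - u * d = v * ?p" using uv by simp
    finally show ?thesis by simp
  qed
  hence "of_int (n + int i * d) = (0::'a)" by (simp only: of_int_eq_0_iff_char_dvd)
  ultimately show ?thesis by (intro exI[of _ i]) simp
qed

theorem proposition3p1:
  fixes p r :: nat and f\<^sub>1 :: "'a::idom poly" and D :: "'a poly \<Rightarrow> 'a poly"
  assumes "prime p"
    and "CHAR('a) = p"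
    and "D = xrf_deriv p r f\<^sub>1"
    and "poly_derivation D"
    and "D \<noteq> (\<lambda>_. 0)"
  shows "locally_nilpotent D \<longleftrightarrow> (\<forall>l::nat. r \<noteq> l * p + 1)"
proof
  assume nil: "locally_nilpotent D"
  show "\<forall>l::nat. r \<noteq> l * p + 1"
  proof (intro allI notI)
    fix l assume r: "r = l * p + 1"
    have F: "pcompose f\<^sub>1 (monom 1 p) \<noteq> 0"
      using assms(3,5) by (auto simp: xrf_deriv_def)
    obtain m where m: "(D ^^ m) (monom 1 1) = 0"
      using nil by (auto simp: locally_nilpotent_def)
    have "of_nat r = (1::'a)"
      unfolding r using of_nat_CHAR[where 'a='a, unfolded assms(2)] by simp
    hence "monom 1 m * (D ^^ m) (monom 1 1) = pcompose f\<^sub>1 (monom 1 p) ^ m * monom 1 (1 + m * r)"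
      using power_mult_xrf_deriv_funpow_power[OF assms(2), of m r f\<^sub>1 1] assms(3) by simp
    with m F show False by simp
  qed
next
  assume r: "\<forall>l::nat. r \<noteq> l * p + 1"
  have unit: "\<not> int p dvd int r - 1"
  proof
    assume dvd: "int p dvd int r - 1"
    show False
    proof (cases r)
      case 0
      with dvd assms(1) show False by (auto dest: zdvd_imp_le prime_gt_1_nat)
    next
      case (Suc k)
      with dvd have "p dvd k" by simp
      then obtain l where "k = l * p" by (metis dvd_div_mult_self)
      with Suc r show False by simp
    qed
  qed
  have "(D ^^ p) (monom 1 n) = 0" for n
  proof -
    obtain i where "i < p" "of_nat n + of_nat i * (of_nat r - 1) = (0::'a)"
      using arith_progression_hits_0_CHAR[where 'a='a, of "int r - 1" "int n"] unit assms(1,2)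
      by auto
    hence "(\<Prod>i<p. of_nat n + of_nat i * (of_nat r - 1)) = (0::'a)"
      by (intro prod_zero) auto
    hence "monom 1 p * (D ^^ p) (monom 1 n) = 0"
      using power_mult_xrf_deriv_funpow_power[OF assms(2), of p r f\<^sub>1 n] assms(3) by simp
    thus ?thesis by simp
  qed
  hence "(D ^^ p) g = 0" for g
    unfolding assms(3) by (rule xrf_deriv_funpow_eq_0I)
  moreover have "p \<ge> 1" using assms(1) by (rule prime_ge_1_nat)
  ultimately show "locally_nilpotent D" by (auto simp: locally_nilpotent_def)
qed

end
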